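(* The Discrete Smooth Integrator, whose steps $(q^t,p^t)\mapsto(q^{t+1},p^{t+1})$ are defined by $$D_1L_d(q^t,q^{t+1})+p^t+N(q^t)\lambda=0,$$ $$0\le\lambda\perp g(q^{t+1})\ge0,$$ $$p^{t+1}=D_2L_d(q^t,q^{t+1})+N(q^{t+1})\mu,$$ $$N(q^{t+1})^TM^{-1}p^{t+1}=0,$$ from states $(q^t,p^t)$ with $g(q^t)\ge0$ satisfying the left-tangency precondition $N(q^t)^TM^{-1}p^t=0$, is symplectic-momentum conserving; that is, its steps preserve the canonical symplectic form and conserve the momenta associated with the symmetries of the discrete Lagrangian and the constraints.
   Context: Configurations and momenta lie in $\mathbb{R}^n$. $M$ is a symmetric positive definite mass matrix, $L_d:\mathbb{R}^n\times\mathbb{R}^n\to\mathbb{R}$ is a smooth discrete Lagrangian (a quadrature approximation, over one time step of fixed size $h$, of the action of $L(q,\dot q)=\frac12\dot q^TM\dot q-V(q)$), and $D_1L_d,D_2L_d\in\mathbb{R}^n$ are its gradients in the first and second arguments. $g=(g_0,\dots,g_m)^T:\mathbb{R}^n\to\mathbb{R}^{m+1}$ is a smooth constraint function; the admissible set is $\{q:g(q)\ge0\}$ (componentwise). $N(q)$ is the active constraint gradient: the matrix whose columns are $\nabla g_i(q)$ for those $i$ with $g_i(q)=0$. The entries of $\lambda$ are indexed by the constraints active at $q^t$, and those of $\mu$ (of arbitrary sign) by the constraints active at $q^{t+1}$. The condition $0\le\lambda\perp g(q^{t+1})\ge0$ means: $\lambda_i\ge0$ for all $i$ active at $q^t$,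 $g_i(q^{t+1})\ge0$ for all $i\in\{0,\dots,m\}$, and $\lambda_i\,g_i(q^{t+1})=0$ for matching entries. A step is a tuple $(q^t,p^t,q^{t+1},p^{t+1})$ for which there exist $\lambda,\mu$ satisfying all the conditions in the claim, including the precondition on $(q^t,p^t)$. Preservation of the symplectic form means: for every smooth family of steps, i.e. every smooth manifold $S$ with smooth maps $q^t,p^t,q^{t+1},p^{t+1}:S\to\mathbb{R}^n$ such that $(q^t(s),p^t(s),q^{t+1}(s),p^{t+1}(s))$ is a step for every $s\in S$, one has $$\sum_{j=1}^n dq^{t+1}_j\wedge dp^{t+1}_j=\sum_{j=1}^n dq^t_j\wedge dp^t_j\quad\text{on } S.$$ Momentum conservation means: if a one-parameter group $\{\Phi_s\}_{s\in\mathbb{R}}$ of diffeomorphisms of $\mathbb{R}^n$, smooth in $s$, with infinitesimal generator $\xi(q)=\frac{d}{ds}\big|_{s=0}\Phi_s(q)$, satisfies $L_d(\Phi_s(q),\Phi_s(q'))=L_d(q,q')$ and $g(\Phi_s(q))=g(q)$ for all $s,q,q'$, then every step satisfies $\xi(q^{t+1})^Tp^{t+1}=\xi(q^t)^Tp^t$. *)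

theory Defs
  imports "HOL-Analysis.Analysis"
begin

section \<open>Smooth maps and gradients\<close>

text \<open>
  \<open>Ck_on k S f\<close> is the usual notion of a \<open>C\<^sup>k\<close> map for open \<open>S\<close> and a finite-dimensional
  domain, where continuity of all iterated directional derivatives in fixed directions
  is the same as continuity of the higher Frechet derivatives.
  It is only applied to open \<open>S\<close>.
\<close>

primrec Ck_on ::
  "nat \<Rightarrow> 'a::euclidean_space set \<Rightarrow> ('a \<Rightarrow> 'b::real_normed_vector) \<Rightarrow> bool" where
  "Ck_on 0 S f \<longleftrightarrow> continuous_on S f"
| "Ck_on (Suc k) S f \<longleftrightarrow> (\<forall>x\<in>S. f differentiable (at x)) \<and>
     (\<forall>v. Ck_on k S (\<lambda>x. frechet_derivative f (at x) v))"

definition smooth_on :: "'a::euclidean_space set \<Rightarrow> ('a \<Rightarrow> 'b::real_normed_vector) \<Rightarrow> bool" where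
  "smooth_on S f \<longleftrightarrow> (\<forall>k. Ck_on k S f)"

definition diffeomorphism :: "('a::euclidean_space \<Rightarrow> 'a) \<Rightarrow> bool" where
  "diffeomorphism f \<longleftrightarrow> bij f \<and> smooth_on UNIV f \<and> smooth_on UNIV (inv f)"

definition grad :: "('a::real_inner \<Rightarrow> real) \<Rightarrow> 'a \<Rightarrow> 'a" where
  "grad f x = (THE D. GDERIV f x :> D)"

lemma grad_eqI:
  assumes "GDERIV f x :> D"
  shows "grad f x = D"
proof -
  have "D' = D" if "GDERIV f x :> D'" for D'
  proof -
    have "(\<lambda>h. inner h D') = (\<lambda>h. inner h D)"
      using assms that unfolding gderiv_def by (rule has_derivative_unique[rotated])
    then have "inner (D' - D) D' = inner (D' - D) D"
      by meson
    then show ?thesis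
      by (metis eq_iff_diff_eq_0 inner_eq_zero_iff inner_diff_right)
  qed
  with assms show ?thesis
    unfolding grad_def by (rule the_equality)
qed

definition D1 :: "('a::real_inner \<Rightarrow> 'b \<Rightarrow> real) \<Rightarrow> 'a \<Rightarrow> 'b \<Rightarrow> 'a" where
  "D1 L x y = grad (\<lambda>x'. L x' y) x"

definition D2 :: "('a \<Rightarrow> 'b::real_inner \<Rightarrow> real) \<Rightarrow> 'a \<Rightarrow> 'b \<Rightarrow> 'b" where
  "D2 L x y = grad (\<lambda>y'. L x y') y"


section \<open>The Discrete Smooth Integrator\<close>

text \<open>
  The constraints are the components of \<open>g\<close>, so the index type \<open>'m\<close> plays the role of
  \<open>{0..m}\<close>. The columns of \<open>N(q)\<close> are indexed by the set \<open>active g q\<close>, which varies with \<open>q\<close>;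
  a vector with entries indexed by that set is a function on \<open>'m\<close> whose values outside
  the set are never used.
\<close>

definition active :: "(real^'n \<Rightarrow> real^'m) \<Rightarrow> real^'n \<Rightarrow> 'm set" where
  "active g q = {i. g q $ i = 0}"

definition N_col :: "(real^'n \<Rightarrow> real^'m) \<Rightarrow> real^'n \<Rightarrow> 'm \<Rightarrow> real^'n" where
  "N_col g q i = grad (\<lambda>x. g x $ i) q"

definition N_times :: "(real^'n \<Rightarrow> real^'m) \<Rightarrow> real^'n \<Rightarrow> ('m \<Rightarrow> real) \<Rightarrow> real^'n" where
  "N_times g q lam = (\<Sum>i\<in>active g q. lam i *\<^sub>R N_col g q i)"

text \<open>\<open>N(q)\<^sup>T M\<^sup>-\<^sup>1 p = 0\<close>, read row by row.\<close>

definition tangent_momentum ::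
  "real^'n^'n \<Rightarrow> (real^'n \<Rightarrow> real^'m) \<Rightarrow> real^'n \<Rightarrow> real^'n \<Rightarrow> bool" where
  "tangent_momentum M g q p \<longleftrightarrow> (\<forall>i\<in>active g q. N_col g q i \<bullet> (matrix_inv M *v p) = 0)"

definition admissible :: "(real^'n \<Rightarrow> real^'m) \<Rightarrow> real^'n \<Rightarrow> bool" where
  "admissible g q \<longleftrightarrow> (\<forall>i. 0 \<le> g q $ i)"

definition DSI_step ::
  "real^'n^'n \<Rightarrow> (real^'n \<Rightarrow> real^'n \<Rightarrow> real) \<Rightarrow> (real^'n \<Rightarrow> real^'m) \<Rightarrow>
   real^'n \<Rightarrow> real^'n \<Rightarrow> real^'n \<Rightarrow> real^'n \<Rightarrow> bool" where
  "DSI_step M Ld g q p q' p' \<longleftrightarrow>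
     admissible g q \<and> tangent_momentum M g q p \<and>
     (\<exists>lam mu.
        D1 Ld q q' + p + N_times g q lam = 0 \<and>
        (\<forall>i\<in>active g q. 0 \<le> lam i) \<and> admissible g q' \<and>
        (\<forall>i\<in>active g q. lam i * g q' $ i = 0) \<and>
        p' = D2 Ld q q' + N_times g q' mu \<and>
        tangent_momentum M g q' p')"


section \<open>Smooth manifolds and the canonical two-form\<close>

text \<open>
  A chart is a pair of its domain and its coordinate map, which takes values in the model
  space \<open>'e\<close>. An atlas need not be maximal.
\<close>

type_synonym ('s, 'e) chart = "'s set \<times> ('s \<Rightarrow> 'e)"

definition is_chart :: "'s topology \<Rightarrow> ('s, 'e::euclidean_space) chart \<Rightarrow> bool" where
  "is_chart X = (\<lambda>(U, \<phi>). openin X U \<and> open (\<phi> ` U) \<and>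
     homeomorphic_map (subtopology X U) (top_of_set (\<phi> ` U)) \<phi>)"

definition smooth_manifold :: "'s topology \<Rightarrow> ('s, 'e::euclidean_space) chart set \<Rightarrow> bool" where
  "smooth_manifold X A \<longleftrightarrow>
     Hausdorff_space X \<and> second_countable X \<and>
     (\<forall>c\<in>A. is_chart X c) \<and> (\<Union>c\<in>A. fst c) = topspace X \<and>
     (\<forall>(U, \<phi>)\<in>A. \<forall>(V, \<psi>)\<in>A. smooth_on (\<phi> ` (U \<inter> V)) (\<psi> \<circ> inv_into U \<phi>))"

definition smooth_map ::
  "('s, 'e::euclidean_space) chart set \<Rightarrow> ('s \<Rightarrow> 'b::real_normed_vector) \<Rightarrow> bool" where
  "smooth_map A f \<longleftrightarrow> (\<forall>(U, \<phi>)\<in>A. smooth_on (\<phi> ` U) (f \<circ> inv_into U \<phi>))"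

text \<open>
  The differential at \<open>s\<close> of a real function on a manifold, as a functional on tangent
  vectors at \<open>s\<close>; a tangent vector is given by its coordinates in the chart \<open>(U, \<phi>)\<close>.
\<close>

definition differential ::
  "('s, 'e::euclidean_space) chart \<Rightarrow> ('s \<Rightarrow> real) \<Rightarrow> 's \<Rightarrow> 'e \<Rightarrow> real" where
  "differential = (\<lambda>(U, \<phi>) f s. frechet_derivative (f \<circ> inv_into U \<phi>) (at (\<phi> s)))"

definition wedge :: "('e \<Rightarrow> real) \<Rightarrow> ('e \<Rightarrow> real) \<Rightarrow> 'e \<Rightarrow> 'e \<Rightarrow> real" where
  "wedge \<alpha> \<beta> u v = \<alpha> u * \<beta> v - \<alpha> v * \<beta> u"

text \<open>\<open>\<Sum>\<^sub>j dq\<^sub>j \<and> dp\<^sub>j\<close> at \<open>s\<close>, for maps \<open>q\<close> and \<open>p\<close> on a manifold, in the chart \<open>c\<close>.\<close>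

definition canonical_form ::
  "('s, 'e::euclidean_space) chart \<Rightarrow> ('s \<Rightarrow> real^'n) \<Rightarrow> ('s \<Rightarrow> real^'n) \<Rightarrow> 's \<Rightarrow> 'e \<Rightarrow> 'e \<Rightarrow> real" where
  "canonical_form c q p s u v =
     (\<Sum>j\<in>UNIV. wedge (differential c (\<lambda>s. q s $ j) s) (differential c (\<lambda>s. p s $ j) s) u v)"

text \<open>
  Preservation along families of steps over the manifold \<open>(X, A)\<close>. Two-forms agree on the
  manifold iff they have the same values on all pairs of tangent vectors at all points; by the
  chart rule this does not depend on the chart around a point, and all charts are required.
\<close>

definition preserves_symplectic_form_on ::
  "'s topology \<Rightarrow> ('s, 'e::euclidean_space) chart set \<Rightarrow>
   (real^'n \<Rightarrow> real^'n \<Rightarrow> real^'n \<Rightarrow> real^'n \<Rightarrow> bool) \<Rightarrow> bool" where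
  "preserves_symplectic_form_on X A step \<longleftrightarrow>
     (\<forall>q p q' p'.
        smooth_map A q \<and> smooth_map A p \<and> smooth_map A q' \<and> smooth_map A p' \<and>
        (\<forall>s\<in>topspace X. step (q s) (p s) (q' s) (p' s)) \<longrightarrow>
        (\<forall>c\<in>A. \<forall>s\<in>fst c. \<forall>u v. canonical_form c q' p' s u v = canonical_form c q p s u v))"


section \<open>Symmetries and momenta\<close>

definition one_parameter_group :: "(real \<Rightarrow> 'a::euclidean_space \<Rightarrow> 'a) \<Rightarrow> bool" where
  "one_parameter_group \<Phi> \<longleftrightarrow>
     (\<forall>s. diffeomorphism (\<Phi> s)) \<and> \<Phi> 0 = id \<and> (\<forall>s t. \<Phi> (s + t) = \<Phi> s \<circ> \<Phi> t) \<and>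
     (\<forall>q. smooth_on UNIV (\<lambda>s. \<Phi> s q))"

definition generator :: "(real \<Rightarrow> 'a::euclidean_space \<Rightarrow> 'a) \<Rightarrow> 'a \<Rightarrow> 'a" where
  "generator \<Phi> q = vector_derivative (\<lambda>s. \<Phi> s q) (at 0)"

definition is_symmetry ::
  "(real^'n \<Rightarrow> real^'n \<Rightarrow> real) \<Rightarrow> (real^'n \<Rightarrow> real^'m) \<Rightarrow> (real \<Rightarrow> real^'n \<Rightarrow> real^'n) \<Rightarrow> bool" where
  "is_symmetry Ld g \<Phi> \<longleftrightarrow>
     (\<forall>s q q'. Ld (\<Phi> s q) (\<Phi> s q') = Ld q q') \<and> (\<forall>s q. g (\<Phi> s q) = g q)"

definition conserves_momenta ::
  "(real^'n \<Rightarrow> real^'n \<Rightarrow> real) \<Rightarrow> (real^'n \<Rightarrow> real^'m) \<Rightarrow>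
   (real^'n \<Rightarrow> real^'n \<Rightarrow> real^'n \<Rightarrow> real^'n \<Rightarrow> bool) \<Rightarrow> bool" where
  "conserves_momenta Ld g step \<longleftrightarrow>
     (\<forall>\<Phi>. one_parameter_group \<Phi> \<and> is_symmetry Ld g \<Phi> \<longrightarrow>
        (\<forall>q p q' p'. step q p q' p' \<longrightarrow> generator \<Phi> q' \<bullet> p' = generator \<Phi> q \<bullet> p))"

end

theory Submission
  imports Defs
begin

text \<open>
  Along a family of steps, consider the discrete action \<open>L\<^sub>d(q, q')\<close>. Substituting the step
  equations into its differential gives
  \<open>d(L\<^sub>d(q, q')) = p' \<cdot> dq' - p \<cdot> dq - \<Sum>\<^sub>i \<lambda>\<^sub>i d(g\<^sub>i(q)) - \<Sum>\<^sub>i \<mu>\<^sub>i d(g\<^sub>i(q'))\<close>, where \<open>i\<close> ranges over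
  the active constraints. The multipliers and the active sets may jump from one point of the
  family to the next, so this identity is only used pointwise. At a given point, every constraint
  function active there has the value zero, while it is nonnegative on the whole family: it has a
  minimum at that point, and its differential is zero. What remains is \<open>d(L\<^sub>d(q, q')) = p' \<cdot> dq' - p \<cdot> dq\<close>, at every
  point (\<open>step_action_derivative\<close>). The right-hand side is a smooth one-form, so
  it may be differentiated once more, and \<open>d \<circ> d = 0\<close> gives \<open>dq' \<and> dp' = dq \<and> dp\<close>
  (\<open>canonical_form_from_action\<close>).

  Momentum conservation comes from the same identity, applied to the curve
  \<open>s \<mapsto> (\<Phi>\<^sub>s(q), \<Phi>\<^sub>s(q'))\<close> through a single step: here the active constraints and the action are
  constant by invariance, so that \<open>0 = p' \<cdot> \<xi>(q') - p \<cdot> \<xi>(q)\<close>.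
\<close>

section \<open>Derivatives and gradients\<close>

lemma smooth_on_differentiable:
  assumes "smooth_on S f" "x \<in> S"
  shows "f differentiable (at x)"
  using assms by (metis Ck_on.simps(2) smooth_on_def)

lemma smooth_on_frechet_derivative_differentiable:
  assumes "smooth_on S f" "x \<in> S"
  shows "(\<lambda>y. frechet_derivative f (at y) v) differentiable (at x)"
proof -
  have "Ck_on (Suc (Suc 0)) S f"
    using assms(1) unfolding smooth_on_def by blast
  then show ?thesis
    using assms(2) by simp
qed

lemma has_derivative_grad:
  fixes f :: "'a::euclidean_space \<Rightarrow> real"
  assumes "f differentiable (at x)"
  shows "(f has_derivative (\<lambda>h. h \<bullet> grad f x)) (at x)"
proof -
  obtain f' where f': "(f has_derivative f') (at x)"
    using assms unfolding differentiable_def by blast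
  interpret linear f'
    using f' by (rule has_derivative_linear)
  have "f' h = h \<bullet> (\<Sum>b\<in>Basis. f' b *\<^sub>R b)" for h
  proof -
    have "f' h = f' (\<Sum>b\<in>Basis. (h \<bullet> b) *\<^sub>R b)"
      by (simp add: euclidean_representation)
    also have "\<dots> = h \<bullet> (\<Sum>b\<in>Basis. f' b *\<^sub>R b)"
      by (simp add: sum scale inner_sum_right mult.commute)
    finally show ?thesis .
  qed
  then have "f' = (\<lambda>h. h \<bullet> (\<Sum>b\<in>Basis. f' b *\<^sub>R b))"
    by blast
  then have "GDERIV f x :> (\<Sum>b\<in>Basis. f' b *\<^sub>R b)"
    using f' unfolding gderiv_def by metis
  then show ?thesis
    using grad_eqI unfolding gderiv_def by metis
qed

lemma has_derivative_partial_gradients: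
  fixes L :: "'a::euclidean_space \<Rightarrow> 'b::euclidean_space \<Rightarrow> real"
  assumes "(\<lambda>(x, y). L x y) differentiable (at (x, y))"
  shows "((\<lambda>(x, y). L x y) has_derivative (\<lambda>(h, k). h \<bullet> D1 L x y + k \<bullet> D2 L x y)) (at (x, y))"
proof -
  obtain L' where L': "((\<lambda>(x, y). L x y) has_derivative L') (at (x, y))"
    using assms unfolding differentiable_def by blast
  have "((\<lambda>x'. L x' y) has_derivative (\<lambda>h. L' (h, 0))) (at x)"
    using has_derivative_compose[where f = "\<lambda>x'. (x', y)" and x = x and s = UNIV,
        OF has_derivative_Pair[OF has_derivative_ident has_derivative_const] L']
    by simp
  moreover from this have "((\<lambda>x'. L x' y) has_derivative (\<lambda>h. h \<bullet> D1 L x y)) (at x)"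
    unfolding D1_def by (intro has_derivative_grad differentiableI)
  ultimately have 1: "(\<lambda>h. L' (h, 0)) = (\<lambda>h. h \<bullet> D1 L x y)"
    by (rule has_derivative_unique)
  have "((\<lambda>y'. L x y') has_derivative (\<lambda>k. L' (0, k))) (at y)"
    using has_derivative_compose[where f = "\<lambda>y'. (x, y')" and x = y and s = UNIV,
        OF has_derivative_Pair[OF has_derivative_const has_derivative_ident] L']
    by simp
  moreover from this have "((\<lambda>y'. L x y') has_derivative (\<lambda>k. k \<bullet> D2 L x y)) (at y)"
    unfolding D2_def by (intro has_derivative_grad differentiableI)
  ultimately have 2: "(\<lambda>k. L' (0, k)) = (\<lambda>k. k \<bullet> D2 L x y)"
    by (rule has_derivative_unique)
  have "L' = (\<lambda>(h, k). h \<bullet> D1 L x y + k \<bullet> D2 L x y)"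
  proof (intro ext, clarify)
    fix h k
    have "L' (h, k) = L' ((h, 0) + (0, k))"
      by simp
    also have "\<dots> = L' (h, 0) + L' (0, k)"
      using L' by (intro linear_add has_derivative_linear)
    finally show "L' (h, k) = h \<bullet> D1 L x y + k \<bullet> D2 L x y"
      using fun_cong[OF 1, of h] fun_cong[OF 2, of k] by simp
  qed
  with L' show ?thesis
    by simp
qed

section \<open>The differential of the discrete action along steps\<close>

lemma inner_N_times_eq_0:
  fixes g :: "real^'n \<Rightarrow> real^'m"
  assumes g: "g differentiable (at (a x))"
    and a: "(a has_derivative a') (at x)"
    and crit: "\<And>i. i \<in> active g (a x) \<Longrightarrow> ((\<lambda>y. g (a y) $ i) has_derivative (\<lambda>h. 0)) (at x)"
  shows "a' h \<bullet> N_times g (a x) lam = 0"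
proof -
  have "a' h \<bullet> N_col g (a x) i = 0" if "i \<in> active g (a x)" for i
  proof -
    have "(\<lambda>z. g z $ i) differentiable (at (a x))"
      using g by (auto simp: differentiable_def intro: bounded_linear.has_derivative[OF bounded_linear_vec_nth])
    then have "((\<lambda>z. g z $ i) has_derivative (\<lambda>k. k \<bullet> N_col g (a x) i)) (at (a x))"
      unfolding N_col_def by (rule has_derivative_grad)
    then have "((\<lambda>y. g (a y) $ i) has_derivative (\<lambda>h. a' h \<bullet> N_col g (a x) i)) (at x)"
      using has_derivative_compose[OF a] by blast
    from has_derivative_unique[OF this crit[OF that]] show ?thesis
      by meson
  qed
  then show ?thesis
    unfolding N_times_def by (simp add: inner_sum_right)
qed

text \<open>
  The parameter space is an arbitrary normed space, so that the lemma serves both for charts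
  of a manifold of steps and for curves generated by a symmetry. The step equations enter
  at \<open>x\<close> alone, because the multipliers may be discontinuous along the family.
\<close>

lemma step_action_derivative:
  fixes g :: "real^'n \<Rightarrow> real^'m"
  assumes step: "DSI_step M Ld g (a x) p (b x) p'"
    and L: "(\<lambda>(q, q'). Ld q q') differentiable (at (a x, b x))"
    and g: "g differentiable (at (a x))" "g differentiable (at (b x))"
    and a: "(a has_derivative a') (at x)"
    and b: "(b has_derivative b') (at x)"
    and crit: "\<And>i. i \<in> active g (a x) \<Longrightarrow> ((\<lambda>y. g (a y) $ i) has_derivative (\<lambda>h. 0)) (at x)"
      "\<And>i. i \<in> active g (b x) \<Longrightarrow> ((\<lambda>y. g (b y) $ i) has_derivative (\<lambda>h. 0)) (at x)"
  shows "((\<lambda>y. Ld (a y) (b y)) has_derivative (\<lambda>h. b' h \<bullet> p' - a' h \<bullet> p)) (at x)"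
proof -
  obtain lam mu where "D1 Ld (a x) (b x) + p + N_times g (a x) lam = 0"
    and p': "p' = D2 Ld (a x) (b x) + N_times g (b x) mu"
    using step unfolding DSI_step_def by blast
  then have D: "D1 Ld (a x) (b x) = - p - N_times g (a x) lam"
    "D2 Ld (a x) (b x) = p' - N_times g (b x) mu"
    by (simp_all add: algebra_simps eq_neg_iff_add_eq_0)
  have "((\<lambda>y. Ld (a y) (b y)) has_derivative
      (\<lambda>h. a' h \<bullet> D1 Ld (a x) (b x) + b' h \<bullet> D2 Ld (a x) (b x))) (at x)"
    using has_derivative_compose[OF has_derivative_Pair[OF a b] has_derivative_partial_gradients[OF L]]
    by simp
  moreover have "a' h \<bullet> D1 Ld (a x) (b x) + b' h \<bullet> D2 Ld (a x) (b x) = b' h \<bullet> p' - a' h \<bullet> p" for h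
    using inner_N_times_eq_0[where a = a, OF g(1) a crit(1)] inner_N_times_eq_0[where a = b, OF g(2) b crit(2)]
    by (simp add: D inner_diff_right)
  ultimately show ?thesis
    by simp
qed

section \<open>Symmetry of second derivatives\<close>

text \<open>
  The second difference of \<open>f\<close> with increments \<open>t u\<close> and \<open>t v\<close> is symmetric in \<open>u\<close> and \<open>v\<close>. By the
  mean value theorem in the direction \<open>u\<close> it equals \<open>t\<close> times an increment of the directional derivative \<open>f' _ u\<close>
  over \<open>t v\<close>, so its quotient by \<open>t\<^sup>2\<close> tends to the derivative of \<open>f' _ u\<close> in the direction \<open>v\<close>.
\<close>

lemma second_difference_tendsto:
  fixes f :: "'a::real_normed_vector \<Rightarrow> real"
  assumes W: "open W" "x \<in> W"
    and f: "\<And>y. y \<in> W \<Longrightarrow> (f has_derivative f' y) (at y)"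
    and A: "((\<lambda>y. f' y u) has_derivative A) (at x)"
  shows "((\<lambda>t. (f (x + t *\<^sub>R u + t *\<^sub>R v) - f (x + t *\<^sub>R u) - f (x + t *\<^sub>R v) + f x) / t\<^sup>2)
    \<longlongrightarrow> A v) (at_right 0)"
proof (rule tendstoI)
  fix e :: real
  assume e: "0 < e"
  define K where "K = norm u + norm v + 1"
  have K: "K > 0"
    unfolding K_def by (smt (verit) norm_ge_zero)
  interpret A: bounded_linear A
    using A by (rule has_derivative_bounded_linear)
  \<comment> \<open>Two increments of length at most \<open>K t\<close> each contribute an error of at most \<open>e t / 3\<close>.\<close>
  define e' where "e' = e / (3 * K)"
  have "e' > 0"
    using e K by (simp add: e'_def)
  then obtain d where d: "d > 0"
    and dA: "\<And>y. norm (y - x) < d \<Longrightarrow> norm (f' y u - f' x u - A (y - x)) \<le> e' * norm (y - x)"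
    using A unfolding has_derivative_at_alt by blast
  obtain r where r: "r > 0" "ball x r \<subseteq> W"
    using W open_contains_ball by blast
  define t0 where "t0 = min d r / K"
  have "t0 > 0"
    using d r K by (simp add: t0_def)
  moreover have "dist ((f (x + t *\<^sub>R u + t *\<^sub>R v) - f (x + t *\<^sub>R u) - f (x + t *\<^sub>R v) + f x) / t\<^sup>2) (A v) < e"
    if t: "0 < t" "t < t0" for t
  proof -
    have tK: "t * K < d" "t * K < r"
      using t K by (auto simp: t0_def field_simps)
    have near: "norm (a *\<^sub>R u + b *\<^sub>R v) \<le> t * K" if "0 \<le> a" "a \<le> t" "0 \<le> b" "b \<le> t" for a b
    proof -
      have "norm (a *\<^sub>R u + b *\<^sub>R v) \<le> a * norm u + b * norm v"
        using that norm_triangle_ineq[of "a *\<^sub>R u" "b *\<^sub>R v"] by simp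
      also have "\<dots> \<le> t * norm u + t * norm v"
        using that by (intro add_mono mult_right_mono) auto
      also have "\<dots> \<le> t * K"
        using t by (simp add: K_def algebra_simps)
      finally show ?thesis .
    qed
    have inW: "x + (a *\<^sub>R u + b *\<^sub>R v) \<in> W" if "0 \<le> a" "a \<le> t" "0 \<le> b" "b \<le> t" for a b
    proof -
      have "x + (a *\<^sub>R u + b *\<^sub>R v) \<in> ball x r"
        using near[OF that] tK dist_add_cancel[of x 0 "a *\<^sub>R u + b *\<^sub>R v"] by simp
      then show ?thesis
        using r by blast
    qed
    define h where "h = (\<lambda>a. f (x + (a *\<^sub>R u + t *\<^sub>R v)) - f (x + (a *\<^sub>R u + 0 *\<^sub>R v)))"
    define h' where "h' = (\<lambda>a. f' (x + (a *\<^sub>R u + t *\<^sub>R v)) u - f' (x + (a *\<^sub>R u + 0 *\<^sub>R v)) u)"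
    have line: "((\<lambda>a. f (x + (a *\<^sub>R u + b *\<^sub>R v))) has_real_derivative f' (x + (a *\<^sub>R u + b *\<^sub>R v)) u) (at a)"
      if "0 \<le> a" "a \<le> t" "0 \<le> b" "b \<le> t" for a b
    proof -
      interpret F: linear "f' (x + (a *\<^sub>R u + b *\<^sub>R v))"
        using f[OF inW[OF that]] by (rule has_derivative_linear)
      have "((\<lambda>a. x + (a *\<^sub>R u + b *\<^sub>R v)) has_derivative (\<lambda>s. s *\<^sub>R u)) (at a)"
        by (auto intro!: derivative_eq_intros)
      from has_derivative_compose[OF this f[OF inW[OF that]]] show ?thesis
        by (simp add: has_field_derivative_def F.scale mult_commute_abs)
    qed
    have "(h has_real_derivative h' a) (at a)" if "0 \<le> a" "a \<le> t" for a
      unfolding h_def h'_def using that t by (intro DERIV_diff line) auto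
    then obtain z where z: "0 < z" "z < t" "h t - h 0 = (t - 0) * h' z"
      using MVT2[of 0 t h h'] t by auto
    let ?y1 = "z *\<^sub>R u + t *\<^sub>R v" and ?y2 = "z *\<^sub>R u + 0 *\<^sub>R v"
    have err: "\<bar>f' (x + y) u - f' x u - A y\<bar> \<le> e * t / 3" if "norm y \<le> t * K" for y
    proof -
      have "\<bar>f' (x + y) u - f' x u - A y\<bar> \<le> e' * norm y"
        using dA[of "x + y"] that tK by simp
      also have "\<dots> \<le> e' * (t * K)"
        using \<open>e' > 0\<close> that by (intro mult_left_mono) auto
      also have "\<dots> = e * t / 3"
        using K by (simp add: e'_def)
      finally show ?thesis .
    qed
    have "A ?y1 - A ?y2 = t * A v"
      by (simp add: A.add A.scaleR)
    then have "\<bar>h' z - t * A v\<bar> \<le> 2 * (e * t / 3)"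
      using err[OF near, of z t] err[OF near, of z 0] z t unfolding h'_def by linarith
    also have "\<dots> < t * e"
      using e t by (simp add: field_simps)
    finally have "\<bar>h' z - t * A v\<bar> / t < e"
      using t by (simp add: field_simps)
    moreover have "(f (x + t *\<^sub>R u + t *\<^sub>R v) - f (x + t *\<^sub>R u) - f (x + t *\<^sub>R v) + f x) / t\<^sup>2 = h' z / t"
    proof -
      have "f (x + t *\<^sub>R u + t *\<^sub>R v) - f (x + t *\<^sub>R u) - f (x + t *\<^sub>R v) + f x = t * h' z"
        using z(3) by (simp add: h_def add.assoc)
      then show ?thesis
        using t by (simp add: power2_eq_square)
    qed
    moreover have "\<bar>h' z - t * A v\<bar> / t = \<bar>h' z / t - A v\<bar>"
    proof -
      have "h' z / t - A v = (h' z - t * A v) / t"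
        using t by (simp add: field_simps)
      then show ?thesis
        using t by (simp add: abs_divide)
    qed
    ultimately show ?thesis
      by (simp add: dist_real_def)
  qed
  ultimately show "\<forall>\<^sub>F t in at_right 0.
      dist ((f (x + t *\<^sub>R u + t *\<^sub>R v) - f (x + t *\<^sub>R u) - f (x + t *\<^sub>R v) + f x) / t\<^sup>2) (A v) < e"
    unfolding eventually_at_right_field by blast
qed

lemma second_derivative_symmetric:
  fixes f :: "'a::real_normed_vector \<Rightarrow> real"
  assumes "open W" "x \<in> W"
    and "\<And>y. y \<in> W \<Longrightarrow> (f has_derivative f' y) (at y)"
    and "((\<lambda>y. f' y u) has_derivative A) (at x)"
    and "((\<lambda>y. f' y v) has_derivative B) (at x)"
  shows "A v = B u"
proof -
  have "((\<lambda>t. (f (x + t *\<^sub>R u + t *\<^sub>R v) - f (x + t *\<^sub>R u) - f (x + t *\<^sub>R v) + f x) / t\<^sup>2)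
    \<longlongrightarrow> A v) (at_right 0)"
    using second_difference_tendsto[OF assms(1-4)] .
  moreover have "((\<lambda>t. (f (x + t *\<^sub>R u + t *\<^sub>R v) - f (x + t *\<^sub>R u) - f (x + t *\<^sub>R v) + f x) / t\<^sup>2)
    \<longlongrightarrow> B u) (at_right 0)"
    using second_difference_tendsto[OF assms(1-3,5), of u]
    by (simp add: algebra_simps)
  ultimately show ?thesis
    by (rule tendsto_unique[rotated]) simp
qed

section \<open>Preservation of the symplectic form\<close>

text \<open>
  This is \<open>d(dF) = 0\<close>, evaluated at \<open>x\<close> on the tangent vectors \<open>u\<close> and \<open>v\<close>. Subtracting from \<open>F\<close>
  the function \<open>p'(x) \<cdot> q' - p(x) \<cdot> q\<close>, with the momenta held at their values at \<open>x\<close>, replaces \<open>p'\<close> and \<open>p\<close> in its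
  differential by functions that vanish at \<open>x\<close>. The second derivatives of \<open>q\<close> and \<open>q'\<close> then drop out
  of the product rule, and the symmetry of the second derivative of the difference is the claim.
\<close>

lemma canonical_form_from_action:
  fixes q p q' p' :: "'e::euclidean_space \<Rightarrow> real^'n" and F :: "'e \<Rightarrow> real"
  assumes W: "open W" "x \<in> W"
    and smooth: "smooth_on W q" "smooth_on W p" "smooth_on W q'" "smooth_on W p'"
    and F: "\<And>y. y \<in> W \<Longrightarrow> (F has_derivative
      (\<lambda>h. frechet_derivative q' (at y) h \<bullet> p' y - frechet_derivative q (at y) h \<bullet> p y)) (at y)"
  shows "frechet_derivative q' (at x) u \<bullet> frechet_derivative p' (at x) v
       - frechet_derivative q' (at x) v \<bullet> frechet_derivative p' (at x) u
       = frechet_derivative q (at x) u \<bullet> frechet_derivative p (at x) v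
       - frechet_derivative q (at x) v \<bullet> frechet_derivative p (at x) u"
proof -
  have der: "(f has_derivative frechet_derivative f (at y)) (at y)"
    if "smooth_on W f" "y \<in> W" for f :: "'e \<Rightarrow> real^'n" and y
    using smooth_on_differentiable[OF that] by (simp add: frechet_derivative_works)
  define G where "G = (\<lambda>y. F y - (q' y \<bullet> p' x - q y \<bullet> p x))"
  define G' where "G' = (\<lambda>y h. frechet_derivative q' (at y) h \<bullet> (p' y - p' x)
    - frechet_derivative q (at y) h \<bullet> (p y - p x))"
  have G: "(G has_derivative G' y) (at y)" if y: "y \<in> W" for y
    using has_derivative_diff[OF F[OF y] has_derivative_diff[
        OF has_derivative_inner_left[OF der[OF smooth(3) y], of "p' x"] has_derivative_inner_left[OF der[OF smooth(1) y], of "p x"]]]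
    unfolding G_def G'_def by (simp add: inner_diff_right algebra_simps)
  have vanishing: "((\<lambda>y. frechet_derivative f (at y) w \<bullet> (k y - k x)) has_derivative
      (\<lambda>h. frechet_derivative f (at x) w \<bullet> frechet_derivative k (at x) h)) (at x)"
    if fk: "smooth_on W f" "smooth_on W k" for f k :: "'e \<Rightarrow> real^'n" and w
  proof -
    obtain f2 where "((\<lambda>y. frechet_derivative f (at y) w) has_derivative f2) (at x)"
      using smooth_on_frechet_derivative_differentiable[OF fk(1) W(2)]
      unfolding differentiable_def by blast
    moreover have "((\<lambda>y. k y - k x) has_derivative frechet_derivative k (at x)) (at x)"
      using has_derivative_diff[OF der[OF fk(2) W(2)] has_derivative_const[of "k x"]] by simp
    ultimately show ?thesis
      using has_derivative_inner by fastforce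
  qed
  have "((\<lambda>y. G' y w) has_derivative (\<lambda>h. frechet_derivative q' (at x) w \<bullet> frechet_derivative p' (at x) h
      - frechet_derivative q (at x) w \<bullet> frechet_derivative p (at x) h)) (at x)" for w
    unfolding G'_def by (intro has_derivative_diff vanishing smooth)
  from second_derivative_symmetric[OF W G this this, of u v] show ?thesis
    by simp
qed

lemma canonical_form_in_coordinates:
  fixes q p :: "'s \<Rightarrow> real^'n" and \<phi> :: "'s \<Rightarrow> 'e::euclidean_space"
  assumes "(q \<circ> inv_into U \<phi>) differentiable (at (\<phi> s))" "(p \<circ> inv_into U \<phi>) differentiable (at (\<phi> s))"
  shows "canonical_form (U, \<phi>) q p s u v =
      frechet_derivative (q \<circ> inv_into U \<phi>) (at (\<phi> s)) u \<bullet> frechet_derivative (p \<circ> inv_into U \<phi>) (at (\<phi> s)) v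
    - frechet_derivative (q \<circ> inv_into U \<phi>) (at (\<phi> s)) v \<bullet> frechet_derivative (p \<circ> inv_into U \<phi>) (at (\<phi> s)) u"
proof -
  have "differential (U, \<phi>) (\<lambda>s. f s $ j) s w = frechet_derivative (f \<circ> inv_into U \<phi>) (at (\<phi> s)) w $ j"
    if "(f \<circ> inv_into U \<phi>) differentiable (at (\<phi> s))" for f :: "'s \<Rightarrow> real^'n" and j w
  proof -
    have "((\<lambda>y. (f \<circ> inv_into U \<phi>) y $ j) has_derivative
        (\<lambda>w. frechet_derivative (f \<circ> inv_into U \<phi>) (at (\<phi> s)) w $ j)) (at (\<phi> s))"
      using that unfolding frechet_derivative_works
      by (rule bounded_linear.has_derivative[OF bounded_linear_vec_nth])
    from frechet_derivative_at[OF this] show ?thesis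
      unfolding differential_def by (simp add: o_def fun_eq_iff)
  qed
  with assms show ?thesis
    unfolding canonical_form_def wedge_def inner_vec_def
    by (simp add: sum_subtractf)
qed

text \<open>
  The chart domain is open, so a constraint function that is active at a point of the
  family has an interior minimum there.
\<close>

lemma active_constraint_critical:
  fixes g :: "real^'n \<Rightarrow> real^'m"
  assumes W: "open W" "y \<in> W"
    and adm: "\<And>z. z \<in> W \<Longrightarrow> admissible g (a z)"
    and g: "g differentiable (at (a y))" and a: "a differentiable (at y)"
    and i: "i \<in> active g (a y)"
  shows "((\<lambda>z. g (a z) $ i) has_derivative (\<lambda>h. 0)) (at y)"
proof -
  obtain D where "((\<lambda>z. g (a z)) has_derivative D) (at y)"
    using g a has_derivative_compose unfolding differentiable_def by blast
  then have D: "((\<lambda>z. g (a z) $ i) has_derivative (\<lambda>h. D h $ i)) (at y)"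
    by (rule bounded_linear.has_derivative[OF bounded_linear_vec_nth])
  have "\<forall>z\<in>W. g (a y) $ i \<le> g (a z) $ i"
    using i adm by (simp add: active_def admissible_def)
  then have "(\<lambda>h. D h $ i) = (\<lambda>h. 0)"
    using differential_zero_maxmin[OF W(2,1) D] by blast
  with D show ?thesis
    by simp
qed

lemma DSI_preserves_symplectic_form:
  fixes g :: "real^'n \<Rightarrow> real^'m" and A :: "('s, 'e::euclidean_space) chart set"
  assumes L: "smooth_on UNIV (\<lambda>(q, q'). Ld q q')" and g: "smooth_on UNIV g"
    and manifold: "smooth_manifold X A"
  shows "preserves_symplectic_form_on X A (DSI_step M Ld g)"
  unfolding preserves_symplectic_form_on_def
proof (intro allI impI ballI, elim conjE)
  fix q p q' p' :: "'s \<Rightarrow> real^'n" and c s u v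
  assume smooth: "smooth_map A q" "smooth_map A p" "smooth_map A q'" "smooth_map A p'"
    and step: "\<forall>s\<in>topspace X. DSI_step M Ld g (q s) (p s) (q' s) (p' s)"
    and "c \<in> A" "s \<in> fst c"
  then obtain U \<phi> where c: "c = (U, \<phi>)" "(U, \<phi>) \<in> A" and s: "s \<in> U"
    by (metis prod.collapse)
  define W \<psi> where "W = \<phi> ` U" and "\<psi> = inv_into U \<phi>"
  have U: "openin X U" and W: "open W"
    using manifold c unfolding smooth_manifold_def is_chart_def W_def by auto
  have x: "\<phi> s \<in> W"
    using s by (simp add: W_def)
  have local: "smooth_on W (f \<circ> \<psi>)" if "smooth_map A f" for f :: "'s \<Rightarrow> real^'n"
    using that c unfolding smooth_map_def W_def \<psi>_def by auto
  have diff: "(f \<circ> \<psi>) differentiable (at y)" if "smooth_map A f" "y \<in> W" for f :: "'s \<Rightarrow> real^'n" and y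
    using smooth_on_differentiable[OF local[OF that(1)] that(2)] .
  have steps: "DSI_step M Ld g ((q \<circ> \<psi>) y) ((p \<circ> \<psi>) y) ((q' \<circ> \<psi>) y) ((p' \<circ> \<psi>) y)" if "y \<in> W" for y
  proof -
    have "\<psi> y \<in> U"
      using that unfolding W_def \<psi>_def by (rule inv_into_into)
    then show ?thesis
      using step openin_subset[OF U] by auto
  qed
  then have adm: "admissible g ((q \<circ> \<psi>) y)" "admissible g ((q' \<circ> \<psi>) y)" if "y \<in> W" for y
    using that unfolding DSI_step_def by blast+
  have gd: "g differentiable (at z)" for z
    using smooth_on_differentiable[OF g] by simp
  have "((\<lambda>y. Ld ((q \<circ> \<psi>) y) ((q' \<circ> \<psi>) y)) has_derivative
      (\<lambda>h. frechet_derivative (q' \<circ> \<psi>) (at y) h \<bullet> (p' \<circ> \<psi>) y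
         - frechet_derivative (q \<circ> \<psi>) (at y) h \<bullet> (p \<circ> \<psi>) y)) (at y)" if y: "y \<in> W" for y
  proof (rule step_action_derivative[where a = "q \<circ> \<psi>" and b = "q' \<circ> \<psi>", OF steps[OF y] _ gd gd])
    show "(\<lambda>(q, q'). Ld q q') differentiable (at ((q \<circ> \<psi>) y, (q' \<circ> \<psi>) y))"
      using smooth_on_differentiable[OF L] by simp
    show "(q \<circ> \<psi> has_derivative frechet_derivative (q \<circ> \<psi>) (at y)) (at y)"
      "(q' \<circ> \<psi> has_derivative frechet_derivative (q' \<circ> \<psi>) (at y)) (at y)"
      using diff[OF smooth(1) y] diff[OF smooth(3) y] by (simp_all add: frechet_derivative_works)
    show "((\<lambda>z. g ((q \<circ> \<psi>) z) $ i) has_derivative (\<lambda>h. 0)) (at y)" if "i \<in> active g ((q \<circ> \<psi>) y)" for i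
      by (rule active_constraint_critical[where a = "q \<circ> \<psi>", OF W y adm(1) gd diff[OF smooth(1) y] that])
    show "((\<lambda>z. g ((q' \<circ> \<psi>) z) $ i) has_derivative (\<lambda>h. 0)) (at y)" if "i \<in> active g ((q' \<circ> \<psi>) y)" for i
      by (rule active_constraint_critical[where a = "q' \<circ> \<psi>", OF W y adm(2) gd diff[OF smooth(3) y] that])
  qed
  from canonical_form_from_action[where p = "p \<circ> \<psi>" and p' = "p' \<circ> \<psi>",
      OF W x smooth[THEN local] this]
  show "canonical_form c q' p' s u v = canonical_form c q p s u v"
    using smooth[THEN diff, OF x] unfolding c(1) \<psi>_def
    by (simp add: canonical_form_in_coordinates)
qed

section \<open>Conservation of momenta\<close>

lemma DSI_conserves_momenta:
  fixes g :: "real^'n \<Rightarrow> real^'m"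
  assumes L: "smooth_on UNIV (\<lambda>(q, q'). Ld q q')" and g: "smooth_on UNIV g"
  shows "conserves_momenta Ld g (DSI_step M Ld g)"
  unfolding conserves_momenta_def
proof (intro allI impI, elim conjE)
  fix \<Phi> :: "real \<Rightarrow> real^'n \<Rightarrow> real^'n" and q p q' p'
  assume grp: "one_parameter_group \<Phi>" and sym: "is_symmetry Ld g \<Phi>"
    and step: "DSI_step M Ld g q p q' p'"
  have \<Phi>0: "\<Phi> 0 z = z" for z
    using grp by (simp add: one_parameter_group_def)
  have flow: "((\<lambda>s. \<Phi> s z) has_derivative (\<lambda>h. h *\<^sub>R generator \<Phi> z)) (at 0)" for z
  proof -
    have "(\<lambda>s. \<Phi> s z) differentiable (at 0)"
      using grp smooth_on_differentiable unfolding one_parameter_group_def by blast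
    then show ?thesis
      using vector_derivative_works unfolding generator_def has_vector_derivative_def by blast
  qed
  have gd: "g differentiable (at z)" for z
    using smooth_on_differentiable[OF g] by simp
  have "((\<lambda>s. Ld (\<Phi> s q) (\<Phi> s q')) has_derivative
      (\<lambda>h. (h *\<^sub>R generator \<Phi> q') \<bullet> p' - (h *\<^sub>R generator \<Phi> q) \<bullet> p)) (at 0)"
  proof (rule step_action_derivative[where a = "\<lambda>s. \<Phi> s q" and b = "\<lambda>s. \<Phi> s q'", OF _ _ gd gd flow flow])
    show "DSI_step M Ld g (\<Phi> 0 q) p (\<Phi> 0 q') p'"
      using step by (simp add: \<Phi>0)
    show "(\<lambda>(q, q'). Ld q q') differentiable (at (\<Phi> 0 q, \<Phi> 0 q'))"
      using smooth_on_differentiable[OF L] by simp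
  qed (use sym in \<open>simp_all add: is_symmetry_def\<close>)
  moreover have "((\<lambda>s. Ld (\<Phi> s q) (\<Phi> s q')) has_derivative (\<lambda>h. 0)) (at 0)"
    using sym by (simp add: is_symmetry_def)
  ultimately have "(\<lambda>h. (h *\<^sub>R generator \<Phi> q') \<bullet> p' - (h *\<^sub>R generator \<Phi> q) \<bullet> p) = (\<lambda>h::real. 0)"
    by (rule has_derivative_unique)
  from fun_cong[OF this, of 1] show "generator \<Phi> q' \<bullet> p' = generator \<Phi> q \<bullet> p"
    by simp
qed

theorem theorem5p1:
  fixes M :: "real^'n^'n"
    and Ld :: "real^'n \<Rightarrow> real^'n \<Rightarrow> real"
    and g :: "real^'n \<Rightarrow> real^'m"
  assumes "transpose M = M" and "\<And>x. x \<noteq> 0 \<Longrightarrow> 0 < x \<bullet> (M *v x)"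
    and "smooth_on UNIV (\<lambda>(q, q'). Ld q q')"
    and "smooth_on UNIV g"
  shows "(\<forall>(X :: 's topology) (A :: ('s, 'e::euclidean_space) chart set).
            smooth_manifold X A \<longrightarrow> preserves_symplectic_form_on X A (DSI_step M Ld g)) \<and>
         conserves_momenta Ld g (DSI_step M Ld g)"
  using DSI_preserves_symplectic_form[OF assms(3,4)] DSI_conserves_momenta[OF assms(3,4)] by blast

end
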